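(* Let $k\ge 5$ be an integer, let $\mathbf{r}=(r_0,r_1,\ldots,r_{k-1})$ be an ordered $k$-tuple of positive integers, and let $h$ be an integer with $2\le h\le \sum_{j=0}^{k-1}r_j-2$. If $A$ is a set of $k$ integers, then $|h^{(\mathbf{r})}A|=L(\mathbf{r},h)$ if and only if $A$ is a $k$-term arithmetic progression.
   Context: Write $A=\{a_0,\ldots,a_{k-1}\}$ with $a_0<a_1<\cdots<a_{k-1}$. Define $$h^{(\mathbf{r})}A=\Big\{\sum_{i=0}^{k-1}s_ia_i:\ s_i\in\mathbb{Z},\ 0\le s_i\le r_i\ (0\le i\le k-1),\ \sum_{i=0}^{k-1}s_i=h\Big\}.$$ Empty sums are $0$. Let $I_{\mathbf{r}}(h)$ be the largest integer (with $0\le I_{\mathbf{r}}(h)\le k$) such that $\sum_{j=0}^{I_{\mathbf{r}}(h)-1}r_j\le h$, and $M_{\mathbf{r}}(h)$ the least integer (with $-1\le M_{\mathbf{r}}(h)\le k-1$) such that $\sum_{j=M_{\mathbf{r}}(h)+1}^{k-1}r_j\le h$. Put $\delta_{\mathbf{r}}(h)=h-\sum_{j=0}^{I_{\mathbf{r}}(h)-1}r_j$, $\theta_{\mathbf{r}}(h)=h-\sum_{j=M_{\mathbf{r}}(h)+1}^{k-1}r_j$, and $$L(\mathbf{r},h)=\sum_{j=M_{\mathbf{r}}(h)+1}^{k-1}j r_j-\sum_{j=0}^{I_{\mathbf{r}}(h)-1}j r_j+M_{\mathbf{r}}(h)\,\theta_{\mathbf{r}}(h)-I_{\mathbf{r}}(h)\,\delta_{\mathbf{r}}(h)+1.$$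 *)

theory Defs
  imports Main
begin

text \<open>
  A tuple \<open>(r\<^sub>0, \<dots>, r\<^sub>k\<^sub>-\<^sub>1)\<close> is a function \<open>r :: nat \<Rightarrow> int\<close> of which only the values at
  \<open>i < k\<close> are used. The elements \<open>a\<^sub>0 < \<dots> < a\<^sub>k\<^sub>-\<^sub>1\<close> of a finite set \<open>A\<close> are the entries of
  \<open>sorted_list_of_set A\<close>.
\<close>

definition restricted_sumset :: "(nat \<Rightarrow> int) \<Rightarrow> int \<Rightarrow> int set \<Rightarrow> int set" where
  "restricted_sumset r h A =
     {(\<Sum>i<card A. s i * (sorted_list_of_set A ! i)) | s :: nat \<Rightarrow> int.
        (\<forall>i<card A. 0 \<le> s i \<and> s i \<le> r i) \<and> (\<Sum>i<card A. s i) = h}"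

definition I_idx :: "nat \<Rightarrow> (nat \<Rightarrow> int) \<Rightarrow> int \<Rightarrow> nat" where
  "I_idx k r h = (GREATEST i. i \<le> k \<and> (\<Sum>j<i. r j) \<le> h)"

text \<open>The index may be \<open>-1\<close>, so it is an integer; in the range considered,
  \<open>nat (m + 1)\<close> loses no information.\<close>

definition M_idx :: "nat \<Rightarrow> (nat \<Rightarrow> int) \<Rightarrow> int \<Rightarrow> int" where
  "M_idx k r h =
     (LEAST m. - 1 \<le> m \<and> m \<le> int k - 1 \<and> (\<Sum>j = nat (m + 1)..<k. r j) \<le> h)"

definition delta :: "nat \<Rightarrow> (nat \<Rightarrow> int) \<Rightarrow> int \<Rightarrow> int" where
  "delta k r h = h - (\<Sum>j<I_idx k r h. r j)"

definition theta :: "nat \<Rightarrow> (nat \<Rightarrow> int) \<Rightarrow> int \<Rightarrow> int" where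
  "theta k r h = h - (\<Sum>j = nat (M_idx k r h + 1)..<k. r j)"

definition L_bound :: "nat \<Rightarrow> (nat \<Rightarrow> int) \<Rightarrow> int \<Rightarrow> int" where
  "L_bound k r h =
     (\<Sum>j = nat (M_idx k r h + 1)..<k. int j * r j) - (\<Sum>j<I_idx k r h. int j * r j)
     + M_idx k r h * theta k r h - int (I_idx k r h) * delta k r h + 1"

definition arith_prog :: "nat \<Rightarrow> int set \<Rightarrow> bool" where
  "arith_prog k A \<longleftrightarrow> (\<exists>a d. d \<noteq> 0 \<and> A = (\<lambda>i. a + int i * d) ` {..<k})"

end

theory Submission
  imports Defs
begin

text \<open>
  Call \<open>s\<close> with \<open>0 \<le> s i \<le> r i\<close> and \<open>\<Sum> s i = h\<close> a configuration, and \<open>\<Sum> i * s i\<close> its rank.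
  Unless the rank is minimal, one can move a unit from some index \<open>i + 1\<close> to \<open>i\<close>; this lowers
  the rank by one and strictly lowers the sum \<open>\<Sum> s i * a i\<close>. Hence a configuration of rank \<open>\<rho>\<close>
  has at least \<open>\<rho> - \<rho>_min + 1\<close> sums up to its own, and dually (complement \<open>s \<mapsto> r - s\<close>) at least
  \<open>\<rho>_max - \<rho> + 1\<close> sums from its own upwards. As \<open>L = \<rho>_max - \<rho>_min + 1\<close>, if there are exactly
  \<open>L\<close> sums then both counts are exact, so the sum of a configuration depends on its rank only.
  Comparing \<open>u + e_i + e_(j+1)\<close> with \<open>u + e_(i+1) + e_j\<close> gives equal gaps at \<open>i\<close> and \<open>j\<close> whenever
  \<open>j \<ge> i + 2\<close>, and for \<open>k \<ge> 5\<close> this makes all gaps equal.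
\<close>

section \<open>Configurations, ranks and sums\<close>

definition config :: "nat \<Rightarrow> (nat \<Rightarrow> int) \<Rightarrow> int \<Rightarrow> (nat \<Rightarrow> int) \<Rightarrow> bool" where
  "config k r h s \<longleftrightarrow> (\<forall>i<k. 0 \<le> s i \<and> s i \<le> r i) \<and> (\<Sum>i<k. s i) = h"

definition wsum :: "nat \<Rightarrow> (nat \<Rightarrow> int) \<Rightarrow> (nat \<Rightarrow> int) \<Rightarrow> int" where
  "wsum k a s = (\<Sum>i<k. s i * a i)"

definition sum_values :: "nat \<Rightarrow> (nat \<Rightarrow> int) \<Rightarrow> (nat \<Rightarrow> int) \<Rightarrow> int \<Rightarrow> int set" where
  "sum_values k a r h = {wsum k a s | s. config k r h s}"

text \<open>The rank obtained by filling all indices below \<open>p\<close> to capacity and placing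
  the remainder at \<open>p\<close>. Keeping \<open>p\<close> as a parameter lets the formula serve
  both \<open>h\<close> and the complementary total.\<close>

definition min_rank :: "nat \<Rightarrow> (nat \<Rightarrow> int) \<Rightarrow> int \<Rightarrow> int" where
  "min_rank p r h = (\<Sum>j<p. int j * r j) + int p * (h - (\<Sum>j<p. r j))"

text \<open>Values of a configuration from \<open>k\<close> on are unconstrained, so configurations
  do not form a finite set whose image could be taken; instead all sums are confined to a bounded
  interval.\<close>

lemma finite_sum_values: "finite (sum_values k a r h)"
proof -
  have "sum_values k a r h \<subseteq> {- (\<Sum>i<k. r i * \<bar>a i\<bar>) .. (\<Sum>i<k. r i * \<bar>a i\<bar>)}"
  proof
    fix x assume "x \<in> sum_values k a r h"
    then obtain s where s: "config k r h s" and x: "x = wsum k a s"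
      by (auto simp: sum_values_def)
    have "\<bar>x\<bar> \<le> (\<Sum>i<k. \<bar>s i * a i\<bar>)"
      unfolding x wsum_def by (rule sum_abs)
    also have "\<dots> \<le> (\<Sum>i<k. r i * \<bar>a i\<bar>)"
      by (rule sum_mono) (use s in \<open>auto simp: config_def abs_mult intro!: mult_right_mono\<close>)
    finally show "x \<in> {- (\<Sum>i<k. r i * \<bar>a i\<bar>) .. (\<Sum>i<k. r i * \<bar>a i\<bar>)}"
      by auto
  qed
  then show ?thesis
    by (rule finite_subset) simp
qed

lemma wsum_add: "wsum k a (\<lambda>i. s i + t i) = wsum k a s + wsum k a t"
  by (simp add: wsum_def algebra_simps sum.distrib)

lemma wsum_diff: "wsum k a (\<lambda>i. s i - t i) = wsum k a s - wsum k a t"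
  by (simp add: wsum_def algebra_simps sum_subtractf)

lemma wsum_of_bool: "i < k \<Longrightarrow> wsum k a (\<lambda>l. of_bool (l = i)) = a i"
  by (simp add: wsum_def of_bool_def if_distrib[where f="\<lambda>x. x * _"] cong: if_cong)

text \<open>With the total as the sum of weight 1, one identity for an arbitrary weight yields
  total, rank and sum at once.\<close>

lemma sum_eq_wsum: "(\<Sum>i<k. s i) = wsum k (\<lambda>_. 1) s"
  by (simp add: wsum_def)

lemma sum_less_split:
  fixes f :: "nat \<Rightarrow> int"
  assumes "p \<le> k"
  shows "(\<Sum>j<k. f j) = (\<Sum>j<p. f j) + (\<Sum>j=p..<k. f j)"
  using sum.atLeastLessThan_concat[of 0 p k f] assms by (simp add: lessThan_atLeast0)

section \<open>Descent to the minimal rank\<close>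

text \<open>With the shifted weight \<open>int j - int p\<close>, terms below \<open>p\<close> are
  smallest when \<open>s j = r j\<close>, and terms from \<open>p\<close> on are nonnegative. The
  shift changes the rank by the constant \<open>p * h\<close>.\<close>

lemma min_rank_le:
  assumes s: "config k r h s" and "p < k"
  shows "min_rank p r h \<le> wsum k int s"
proof -
  have "(\<Sum>j<p. (int j - int p) * r j) \<le> (\<Sum>j<p. (int j - int p) * s j)"
    by (rule sum_mono) (use s \<open>p < k\<close> in \<open>auto simp: config_def intro!: mult_left_mono_neg\<close>)
  moreover have "0 \<le> (\<Sum>j=p..<k. (int j - int p) * s j)"
    by (rule sum_nonneg) (use s in \<open>auto simp: config_def\<close>)
  ultimately have "(\<Sum>j<p. (int j - int p) * r j) \<le> (\<Sum>j<k. (int j - int p) * s j)"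
    using sum_less_split[of p k "\<lambda>j. (int j - int p) * s j"] \<open>p < k\<close> by simp
  also have "\<dots> = wsum k int s - int p * h"
    using s by (simp add: wsum_def config_def algebra_simps sum_subtractf flip: sum_distrib_left)
  finally show ?thesis
    by (simp add: min_rank_def algebra_simps sum_subtractf sum_distrib_left)
qed

text \<open>Fullness propagates downwards: a positive entry forces the one before it to be full,
  hence positive because capacities are positive.\<close>

lemma stuck_full_below:
  assumes pos: "\<And>j. j < k \<Longrightarrow> 0 < (r j :: int)"
    and stuck: "\<And>i. Suc i < k \<Longrightarrow> 0 < s (Suc i) \<Longrightarrow> s i = r i"
    and "i < j" "j < k" "0 < s j"
  shows "s i = r i"
  using \<open>i < j\<close> \<open>j < k\<close> \<open>0 < s j\<close>
proof (induction j)
  case (Suc j)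
  then have "s j = r j"
    using stuck by blast
  then show ?case
    using Suc pos[of j] by (cases "i = j") auto
qed simp

text \<open>If no unit can move down, the configuration is the greedy one. A deficit below
  \<open>p\<close> would empty everything beyond it and leave a total below \<open>h\<close>; a
  positive entry beyond \<open>p\<close> would fill everything up to \<open>p\<close> and push the
  total above \<open>h\<close>.\<close>

lemma stuck_min_rank:
  assumes pos: "\<And>j. j < k \<Longrightarrow> 0 < r j"
    and s: "config k r h s" and "p < k"
    and p: "(\<Sum>j<p. r j) \<le> h" "h \<le> (\<Sum>j<Suc p. r j)"
    and stuck: "\<And>i. Suc i < k \<Longrightarrow> 0 < s (Suc i) \<Longrightarrow> s i = r i"
  shows "wsum k int s = min_rank p r h"
proof -
  note full = stuck_full_below[of k r s, OF pos stuck]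
  have s0: "0 \<le> s j" "s j \<le> r j" if "j < k" for j
    using s that by (auto simp: config_def)
  have sh: "(\<Sum>j<k. s j) = h"
    using s by (simp add: config_def)
  have lo: "s j = r j" if "j < p" for j
  proof (rule ccontr)
    assume "s j \<noteq> r j"
    then have lt: "s j < r j"
      using s0[of j] that \<open>p < k\<close> by force
    have "s l = 0" if "j < l" "l < k" for l
      using full[of j l] s0[of l] that \<open>s j \<noteq> r j\<close> by force
    then have "(\<Sum>l=Suc j..<k. s l) = 0"
      by (intro sum.neutral) auto
    then have "h = (\<Sum>l<Suc j. s l)"
      using sum_less_split[of "Suc j" k s] that \<open>p < k\<close> sh by simp
    also have "\<dots> < (\<Sum>l<Suc j. r l)"
      by (rule sum_strict_mono_ex1) (use lt s0 that \<open>p < k\<close> in auto)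
    also have "\<dots> \<le> (\<Sum>l<p. r l)"
      by (rule sum_mono2) (use that pos \<open>p < k\<close> in \<open>auto simp: less_imp_le\<close>)
    finally show False
      using p by simp
  qed
  have hi: "s j = 0" if "p < j" "j < k" for j
  proof (rule ccontr)
    assume "s j \<noteq> 0"
    then have j: "0 < s j"
      using s0[of j] that by force
    have "(\<Sum>l<Suc p. r l) = (\<Sum>l<Suc p. s l)"
      by (rule sum.cong) (use full[of _ j] j that in auto)
    moreover have "s j \<le> (\<Sum>l=Suc p..<k. s l)"
      by (rule member_le_sum) (use that s0 in auto)
    ultimately show False
      using sum_less_split[of "Suc p" k s] that p sh j by simp
  qed
  \<comment> \<open>The weight stays free: weight 1 determines \<open>s p\<close> from the total,
    and weight \<open>int\<close> then gives the rank.\<close>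
  have split: "(\<Sum>j<k. f j * s j) = (\<Sum>j<p. f j * r j) + f p * s p" for f
  proof -
    have "(\<Sum>j<p. f j * s j) = (\<Sum>j<p. f j * r j)"
      by (rule sum.cong) (use lo in auto)
    moreover have "(\<Sum>j=Suc p..<k. f j * s j) = 0"
      by (rule sum.neutral) (use hi in auto)
    ultimately show ?thesis
      using sum_less_split[of "Suc p" k "\<lambda>j. f j * s j"] \<open>p < k\<close> by simp
  qed
  show ?thesis
    using split[of int] split[of "\<lambda>_. 1"] sh
    by (simp add: wsum_def min_rank_def mult.commute[of _ "int _"])
qed

lemma down_move:
  assumes pos: "\<And>j. j < k \<Longrightarrow> 0 < r j"
    and s: "config k r h s" and "p < k"
    and p: "(\<Sum>j<p. r j) \<le> h" "h \<le> (\<Sum>j<Suc p. r j)"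
    and neq: "wsum k int s \<noteq> min_rank p r h"
    and mono: "\<And>i. Suc i < k \<Longrightarrow> a i < a (Suc i)"
  obtains t where "config k r h t" "wsum k int t = wsum k int s - 1" "wsum k a t < wsum k a s"
proof -
  obtain i where i: "Suc i < k" "0 < s (Suc i)" "s i \<noteq> r i"
    using stuck_min_rank[OF pos s \<open>p < k\<close> p] neq by blast
  \<comment> \<open>One unit moves from \<open>Suc i\<close> to \<open>i\<close>; there is room
    because \<open>s i\<close> is below capacity.\<close>
  define t where "t = (\<lambda>l. s l + of_bool (l = i) - of_bool (l = Suc i))"
  have t: "wsum k b t = wsum k b s + b i - b (Suc i)" for b
    using i by (simp add: t_def wsum_add wsum_diff wsum_of_bool)
  have "s i < r i"
    using s i by (simp add: config_def order_less_le)
  then have "config k r h t"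
    using s i t[of "\<lambda>_. 1"] by (auto simp: config_def sum_eq_wsum t_def of_bool_def)
  then show ?thesis
    using that[of t] t[of int] t[of a] mono[OF i(1)] by simp
qed

text \<open>Induction on the excess of the rank over the minimum: a downward move gives a
  configuration with strictly smaller sum, so the sum of \<open>s\<close> is new to those already
  counted.\<close>

lemma card_sums_below:
  assumes pos: "\<And>j. j < k \<Longrightarrow> 0 < r j"
    and s: "config k r h s" and "p < k"
    and p: "(\<Sum>j<p. r j) \<le> h" "h \<le> (\<Sum>j<Suc p. r j)"
    and mono: "\<And>i. Suc i < k \<Longrightarrow> a i < a (Suc i)"
  shows "wsum k int s - min_rank p r h + 1 \<le> int (card {x \<in> sum_values k a r h. x \<le> wsum k a s})"
proof -
  have "int n + 1 \<le> int (card {x \<in> sum_values k a r h. x \<le> wsum k a s})"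
    if "config k r h s" "wsum k int s = min_rank p r h + int n" for n s
    using that
  proof (induction n arbitrary: s)
    case 0
    then have "wsum k a s \<in> {x \<in> sum_values k a r h. x \<le> wsum k a s}"
      by (auto simp: sum_values_def)
    moreover have "finite {x \<in> sum_values k a r h. x \<le> wsum k a s}"
      using finite_sum_values by simp
    ultimately have "0 < card {x \<in> sum_values k a r h. x \<le> wsum k a s}"
      by (auto simp only: card_gt_0_iff)
    then show ?case
      by simp
  next
    case (Suc n)
    obtain t where t: "config k r h t" "wsum k int t = wsum k int s - 1" "wsum k a t < wsum k a s"
      using down_move[where a=a, OF pos Suc.prems(1) \<open>p < k\<close> p _ mono] Suc.prems(2) by auto
    let ?T = "{x \<in> sum_values k a r h. x \<le> wsum k a t}"
    have fin: "finite {x \<in> sum_values k a r h. x \<le> b}" for b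
      using finite_sum_values by simp
    have "insert (wsum k a s) ?T \<subseteq> {x \<in> sum_values k a r h. x \<le> wsum k a s}"
      using t Suc.prems(1) by (auto simp: sum_values_def)
    then have "card (insert (wsum k a s) ?T) \<le> card {x \<in> sum_values k a r h. x \<le> wsum k a s}"
      by (intro card_mono fin)
    moreover have "card (insert (wsum k a s) ?T) = Suc (card ?T)"
      using t fin by (intro card_insert_disjoint) auto
    moreover have "int n + 1 \<le> int (card ?T)"
      by (rule Suc.IH) (use t Suc.prems in auto)
    ultimately show ?case
      by simp
  qed
  from this[OF s, of "nat (wsum k int s - min_rank p r h)"] show ?thesis
    using min_rank_le[OF s \<open>p < k\<close>] by simp
qed

section \<open>Complementation and counting upwards\<close>

lemma config_complement:
  "config k r h s \<Longrightarrow> config k r ((\<Sum>j<k. r j) - h) (\<lambda>i. r i - s i)"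
  by (auto simp: config_def sum_subtractf)

text \<open>The reflection \<open>x \<mapsto> wsum k a r - x\<close> carries sums of the
  complementary total below that of \<open>r - s\<close> to sums of total \<open>h\<close> above
  that of \<open>s\<close>, so the downward count transfers.\<close>

lemma card_sums_above:
  assumes pos: "\<And>j. j < k \<Longrightarrow> 0 < r j"
    and s: "config k r h s" and "p < k"
    and p: "(\<Sum>j<p. r j) \<le> (\<Sum>j<k. r j) - h" "(\<Sum>j<k. r j) - h \<le> (\<Sum>j<Suc p. r j)"
    and mono: "\<And>i. Suc i < k \<Longrightarrow> a i < a (Suc i)"
  shows "wsum k int r - min_rank p r ((\<Sum>j<k. r j) - h) - wsum k int s + 1
    \<le> int (card {x \<in> sum_values k a r h. wsum k a s \<le> x})"
proof -
  let ?h = "(\<Sum>j<k. r j) - h"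
  let ?c = "\<lambda>i. r i - s i"
  have "{x \<in> sum_values k a r ?h. x \<le> wsum k a ?c}
      \<subseteq> (\<lambda>x. wsum k a r - x) ` {x \<in> sum_values k a r h. wsum k a s \<le> x}"
  proof
    fix x assume x: "x \<in> {x \<in> sum_values k a r ?h. x \<le> wsum k a ?c}"
    then obtain t where t: "config k r ?h t" "x = wsum k a t"
      by (auto simp: sum_values_def)
    have "config k r h (\<lambda>i. r i - t i)"
      using config_complement[OF t(1)] by simp
    then have "wsum k a r - x \<in> sum_values k a r h"
      using t(2) by (auto simp: sum_values_def wsum_diff[symmetric])
    then show "x \<in> (\<lambda>x. wsum k a r - x) ` {x \<in> sum_values k a r h. wsum k a s \<le> x}"
      using x by (intro image_eqI[of _ _ "wsum k a r - x"]) (auto simp: wsum_diff)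
  qed
  then have "card {x \<in> sum_values k a r ?h. x \<le> wsum k a ?c} \<le> card {x \<in> sum_values k a r h. wsum k a s \<le> x}"
    by (rule surj_card_le[rotated]) (simp add: finite_sum_values)
  then show ?thesis
    using card_sums_below[where a=a, OF pos config_complement[OF s] \<open>p < k\<close> p mono] by (simp add: wsum_diff)
qed

section \<open>Existence of configurations\<close>

lemma ex_bounded_with_sum:
  fixes c :: "nat \<Rightarrow> int"
  assumes "\<And>i. i < k \<Longrightarrow> 0 \<le> c i" "0 \<le> m" "m \<le> (\<Sum>i<k. c i)"
  shows "\<exists>s. (\<forall>i<k. 0 \<le> s i \<and> s i \<le> c i) \<and> (\<Sum>i<k. s i) = m"
  using assms
proof (induction k arbitrary: m)
  case (Suc k)
  \<comment> \<open>Greedy choice: the first \<open>k\<close> entries absorb as much of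
    \<open>m\<close> as they can, and the last takes the rest.\<close>
  define n where "n = min m (\<Sum>i<k. c i)"
  have "0 \<le> (\<Sum>i<k. c i)"
    by (rule sum_nonneg) (use Suc.prems(1) in auto)
  then have "\<exists>s. (\<forall>i<k. 0 \<le> s i \<and> s i \<le> c i) \<and> (\<Sum>i<k. s i) = n"
    by (intro Suc.IH) (use Suc.prems in \<open>auto simp: n_def\<close>)
  then obtain s where s: "\<forall>i<k. 0 \<le> s i \<and> s i \<le> c i" "(\<Sum>i<k. s i) = n"
    by blast
  have "0 \<le> m - n" "m - n \<le> c k"
    using Suc.prems by (auto simp: n_def min_def)
  moreover have "(\<Sum>i<k. (s(k := m - n)) i) = n"
    unfolding s(2)[symmetric] by (rule sum.cong) auto
  ultimately show ?case
    using s by (intro exI[of _ "s(k := m - n)"]) (auto simp: less_Suc_eq)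
qed auto

section \<open>The bound \<open>L\<close> as a rank interval\<close>

lemma I_idx_properties:
  fixes r :: "nat \<Rightarrow> int"
  assumes "0 \<le> h" "h < (\<Sum>j<k. r j)"
  shows "I_idx k r h < k" "(\<Sum>j<I_idx k r h. r j) \<le> h" "h < (\<Sum>j<Suc (I_idx k r h). r j)"
proof -
  let ?P = "\<lambda>i. i \<le> k \<and> (\<Sum>j<i. r j) \<le> h"
  have "?P (I_idx k r h)"
    unfolding I_idx_def by (rule GreatestI_nat[of ?P 0 k]) (use assms in auto)
  moreover from this assms show "I_idx k r h < k"
    by (cases "I_idx k r h = k") auto
  moreover have "\<not> ?P (Suc (I_idx k r h))"
    using Greatest_le_nat[of ?P "Suc (I_idx k r h)" k] unfolding I_idx_def by auto
  ultimately show "(\<Sum>j<I_idx k r h. r j) \<le> h" "h < (\<Sum>j<Suc (I_idx k r h). r j)"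
    by auto
qed

text \<open>The value \<open>-1\<close> would require the whole total to be at most
  \<open>h\<close>, so the integer minimum is a minimum over natural numbers.\<close>

lemma M_idx_properties:
  fixes r :: "nat \<Rightarrow> int"
  assumes pos: "\<And>j. j < k \<Longrightarrow> 0 < r j" and "0 \<le> h" "h < (\<Sum>j<k. r j)"
  obtains p where "M_idx k r h = int p" "p < k"
    "(\<Sum>j=Suc p..<k. r j) \<le> h" "h < (\<Sum>j=p..<k. r j)"
proof -
  let ?Q = "\<lambda>p. p < k \<and> (\<Sum>j=Suc p..<k. r j) \<le> h"
  define p where "p = (LEAST p. ?Q p)"
  have "0 < k"
    using assms by (cases k) auto
  then have Q: "?Q p"
    unfolding p_def by (intro LeastI[of ?Q "k - 1"]) (use assms in auto)
  have least: "p \<le> q" if "?Q q" for q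
    unfolding p_def using that by (rule Least_le)
  have "h < (\<Sum>j=p..<k. r j)"
  proof (cases p)
    case 0
    then show ?thesis
      using assms by (simp add: lessThan_atLeast0)
  next
    case (Suc q)
    then show ?thesis
      using Q least[of q] by force
  qed
  moreover have "M_idx k r h = int p"
    unfolding M_idx_def
  proof (rule Least_equality)
    show "-1 \<le> int p \<and> int p \<le> int k - 1 \<and> (\<Sum>j=nat (int p + 1)..<k. r j) \<le> h"
      using Q by (auto simp: nat_add_distrib)
  next
    fix m assume m: "-1 \<le> m \<and> m \<le> int k - 1 \<and> (\<Sum>j=nat (m + 1)..<k. r j) \<le> h"
    show "int p \<le> m"
    proof (cases "m = -1")
      case True
      then show ?thesis
        using m assms by (simp add: lessThan_atLeast0)
    next
      case False
      then have "nat (m + 1) = Suc (nat m)" "nat m < k"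
        using m by auto
      then show ?thesis
        using m False least[of "nat m"] by auto
    qed
  qed
  ultimately show ?thesis
    using that Q by blast
qed

text \<open>Take \<open>p\<close> as \<open>I_idx\<close> and \<open>q\<close> as
  \<open>M_idx\<close>. Filling \<open>h\<close> from the top stops at the index where filling the
  complementary total from the bottom stops, so the rank of \<open>r\<close> less the complementary
  minimal rank is the maximal rank.\<close>

lemma L_bound_eq_ranks:
  assumes pos: "\<And>j. j < k \<Longrightarrow> 0 < r j" and "0 \<le> h" "h < (\<Sum>j<k. r j)"
  obtains p q where "p < k" "(\<Sum>j<p. r j) \<le> h" "h \<le> (\<Sum>j<Suc p. r j)"
    "q < k" "(\<Sum>j<q. r j) \<le> (\<Sum>j<k. r j) - h" "(\<Sum>j<k. r j) - h \<le> (\<Sum>j<Suc q. r j)"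
    "L_bound k r h = wsum k int r - min_rank q r ((\<Sum>j<k. r j) - h) - min_rank p r h + 1"
proof -
  obtain q where q: "M_idx k r h = int q" "q < k"
    "(\<Sum>j=Suc q..<k. r j) \<le> h" "h < (\<Sum>j=q..<k. r j)"
    using M_idx_properties[OF assms] by metis
  have n: "nat (1 + int q) = Suc q"
    by simp
  have split: "(\<Sum>j<k. f j) = (\<Sum>j<q. f j) + f q + (\<Sum>j=Suc q..<k. f j)" for f :: "nat \<Rightarrow> int"
    using sum_less_split[of "Suc q" k f] q by simp
  have "L_bound k r h
      = wsum k int r - min_rank q r ((\<Sum>j<k. r j) - h) - min_rank (I_idx k r h) r h + 1"
    using split[of "\<lambda>j. r j * int j"] split[of r]
    by (simp add: L_bound_def wsum_def min_rank_def q(1) theta_def delta_def n algebra_simps)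
  then show ?thesis
    using that[of "I_idx k r h" q] I_idx_properties[OF assms(2,3)] q
      sum_less_split[of q k r] sum_less_split[of "Suc q" k r] by simp
qed

section \<open>Rigidity in the case of equality\<close>

text \<open>If \<open>s\<close> had a larger sum than \<open>t\<close> at the same rank, the sums up
  to that of \<open>t\<close> and those from that of \<open>s\<close> on would be disjoint and
  number at least \<open>L + 1\<close>.\<close>

lemma equal_rank_equal_sum:
  assumes pos: "\<And>j. j < k \<Longrightarrow> 0 < r j" and h: "0 \<le> h" "h < (\<Sum>j<k. r j)"
    and mono: "\<And>i. Suc i < k \<Longrightarrow> a i < a (Suc i)"
    and card: "int (card (sum_values k a r h)) = L_bound k r h"
    and s: "config k r h s" and t: "config k r h t"
    and rank: "wsum k int s = wsum k int t"
  shows "wsum k a s = wsum k a t"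
proof -
  \<comment> \<open>Proved for all pairs, so that exchanging \<open>s\<close> and \<open>t\<close>
    gives equality.\<close>
  have ge: "wsum k a s \<le> wsum k a t"
    if s: "config k r h s" and t: "config k r h t" and rank: "wsum k int s = wsum k int t" for s t
  proof (rule ccontr)
    assume "\<not> ?thesis"
    then have disj: "{x \<in> sum_values k a r h. x \<le> wsum k a t} \<inter> {x \<in> sum_values k a r h. wsum k a s \<le> x} = {}"
      by auto
    obtain p q where p: "p < k" "(\<Sum>j<p. r j) \<le> h" "h \<le> (\<Sum>j<Suc p. r j)"
      and q: "q < k" "(\<Sum>j<q. r j) \<le> (\<Sum>j<k. r j) - h" "(\<Sum>j<k. r j) - h \<le> (\<Sum>j<Suc q. r j)"
      and L: "L_bound k r h = wsum k int r - min_rank q r ((\<Sum>j<k. r j) - h) - min_rank p r h + 1"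
      using L_bound_eq_ranks[OF pos h] by metis
    have "card {x \<in> sum_values k a r h. x \<le> wsum k a t} + card {x \<in> sum_values k a r h. wsum k a s \<le> x}
        = card ({x \<in> sum_values k a r h. x \<le> wsum k a t} \<union> {x \<in> sum_values k a r h. wsum k a s \<le> x})"
      by (rule card_Un_disjoint[symmetric]) (use disj finite_sum_values in auto)
    also have "\<dots> \<le> card (sum_values k a r h)"
      by (rule card_mono) (auto simp: finite_sum_values)
    finally show False
      using card_sums_below[where a=a, OF pos t p mono] card_sums_above[where a=a, OF pos s q mono] card L rank by linarith
  qed
  show ?thesis
    using ge[OF s t rank] ge[OF t s rank[symmetric]] by simp
qed

lemma far_gaps_equal:
  assumes pos: "\<And>j. j < k \<Longrightarrow> 0 < r j" and h: "2 \<le> h" "h \<le> (\<Sum>j<k. r j) - 2"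
    and mono: "\<And>i. Suc i < k \<Longrightarrow> a i < a (Suc i)"
    and card: "int (card (sum_values k a r h)) = L_bound k r h"
    and ij: "Suc i < j" "Suc j < k"
  shows "a (Suc i) - a i = a (Suc j) - a j"
proof -
  define e where "e = (\<lambda>i l::nat. of_bool (l = i) :: int)"
  have e: "wsum k b (e l) = b l" if "l < k" for b l
    using that by (simp add: e_def wsum_of_bool)
  \<comment> \<open>Capacities left after reserving one unit at each of the four indices, which are
    distinct because \<open>Suc i < j\<close>. They add up to the full total less 4, so the bounds
    on \<open>h\<close> leave room for a common part \<open>u\<close> of total
    \<open>h - 2\<close>.\<close>
  define c where "c = (\<lambda>l. r l - (e i l + e (Suc i) l + e j l + e (Suc j) l))"
  have "(\<Sum>l<k. c l) = (\<Sum>l<k. r l) - 4"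
    unfolding sum_eq_wsum c_def using ij by (simp add: wsum_diff wsum_add e)
  moreover have "0 \<le> c l" if "l < k" for l
    using pos[OF that] ij by (auto simp: c_def e_def of_bool_def)
  ultimately obtain u where u: "\<forall>l<k. 0 \<le> u l \<and> u l \<le> c l" "(\<Sum>l<k. u l) = h - 2"
    using ex_bounded_with_sum[of k c "h - 2"] h by auto
  define s where "s = (\<lambda>l. u l + e (Suc i) l + e j l)"
  define t where "t = (\<lambda>l. u l + e i l + e (Suc j) l)"
  have s: "wsum k b s = wsum k b u + b (Suc i) + b j" for b
    using ij by (simp add: s_def wsum_add e)
  have t: "wsum k b t = wsum k b u + b i + b (Suc j)" for b
    using ij by (simp add: t_def wsum_add e)
  have h0: "0 \<le> h" "h < (\<Sum>j<k. r j)"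
    using h by simp_all
  have e0: "0 \<le> e l m" for l m
    by (simp add: e_def)
  have bnd: "0 \<le> s l \<and> s l \<le> r l" "0 \<le> t l \<and> t l \<le> r l" if "l < k" for l
    using u(1)[rule_format, OF that] e0[of i l] e0[of "Suc i" l] e0[of j l] e0[of "Suc j" l]
    unfolding s_def t_def c_def by linarith+
  have "config k r h s" "config k r h t"
    using bnd s[of "\<lambda>_. 1"] t[of "\<lambda>_. 1"] u(2) by (auto simp: config_def sum_eq_wsum)
  moreover have "wsum k int s = wsum k int t"
    by (simp add: s t)
  ultimately have "wsum k a s = wsum k a t"
    by (intro equal_rank_equal_sum[where a=a, OF pos h0 mono card])
  then show ?thesis
    by (simp add: s t)
qed

text \<open>Gaps from index 2 on compare directly with gap 0. Gap 1 is adjacent to it and is reached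
  through gap 3, which exists because \<open>k \<ge> 5\<close>.\<close>

lemma all_gaps_equal:
  fixes a :: "nat \<Rightarrow> int"
  assumes "k \<ge> 5"
    and far: "\<And>i j. Suc i < j \<Longrightarrow> Suc j < k \<Longrightarrow> a (Suc i) - a i = a (Suc j) - a j"
    and "Suc i < k"
  shows "a (Suc i) - a i = a 1 - a 0"
proof -
  consider "i = 0" | "i = 1" | "Suc 0 < i"
    by linarith
  then show ?thesis
  proof cases
    case 2
    then show ?thesis
      using far[of 1 3] far[of 0 3] \<open>k \<ge> 5\<close> by simp
  qed (use far[of 0 i] \<open>Suc i < k\<close> in auto)
qed

section \<open>Arithmetic progressions attain \<open>L\<close>\<close>

text \<open>Sums are an affine function of the rank, which ranges in an interval of \<open>L\<close>
  integers; this is the upper bound. The counts below and above one configuration give the lower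
  bound.\<close>

lemma card_sums_affine:
  assumes pos: "\<And>j. j < k \<Longrightarrow> 0 < r j" and h: "0 \<le> h" "h < (\<Sum>j<k. r j)"
    and "0 < d" and a: "\<And>i. i < k \<Longrightarrow> a i = b + int i * d"
  shows "int (card (sum_values k a r h)) = L_bound k r h"
proof -
  obtain p q where p: "p < k" "(\<Sum>j<p. r j) \<le> h" "h \<le> (\<Sum>j<Suc p. r j)"
    and q: "q < k" "(\<Sum>j<q. r j) \<le> (\<Sum>j<k. r j) - h" "(\<Sum>j<k. r j) - h \<le> (\<Sum>j<Suc q. r j)"
    and L: "L_bound k r h = wsum k int r - min_rank q r ((\<Sum>j<k. r j) - h) - min_rank p r h + 1"
    using L_bound_eq_ranks[OF pos h] by metis
  let ?lo = "min_rank p r h" and ?hi = "wsum k int r - min_rank q r ((\<Sum>j<k. r j) - h)"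
  have mono: "a i < a (Suc i)" if "Suc i < k" for i
    using a[of i] a[of "Suc i"] that \<open>0 < d\<close> by (simp add: algebra_simps)
  have rank: "?lo \<le> wsum k int s" "wsum k int s \<le> ?hi" if "config k r h s" for s
    using min_rank_le[OF that p(1)] min_rank_le[OF config_complement[OF that] q(1)]
    by (simp_all add: wsum_diff)
  have affine: "wsum k a s = h * b + wsum k int s * d" if "config k r h s" for s
  proof -
    have "wsum k a s = (\<Sum>i<k. s i * b + s i * int i * d)"
      unfolding wsum_def by (rule sum.cong) (auto simp: a algebra_simps)
    then show ?thesis
      using that by (simp add: wsum_def config_def sum.distrib sum_distrib_right[symmetric])
  qed
  have "sum_values k a r h \<subseteq> (\<lambda>m. h * b + m * d) ` {?lo..?hi}"
    unfolding sum_values_def using rank affine by auto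
  then have "card (sum_values k a r h) \<le> card {?lo..?hi}"
    by (rule surj_card_le[rotated]) simp
  obtain s where s: "config k r h s"
    using ex_bounded_with_sum[of k r h] pos h by (auto simp: config_def less_imp_le)
  \<comment> \<open>The extra 1 is the sum of \<open>s\<close> itself, counted on both
    sides.\<close>
  have one: "card {x \<in> sum_values k a r h. x \<le> wsum k a s} + card {x \<in> sum_values k a r h. wsum k a s \<le> x}
      = card (sum_values k a r h) + 1"
  proof -
    let ?X = "{x \<in> sum_values k a r h. x \<le> wsum k a s}" and ?Y = "{x \<in> sum_values k a r h. wsum k a s \<le> x}"
    have "?X \<union> ?Y = sum_values k a r h" "?X \<inter> ?Y = {wsum k a s}"
      using s by (auto simp: sum_values_def)
    then show ?thesis
      using card_Un_Int[of ?X ?Y] finite_sum_values[of k a r h] by simp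
  qed
  have "L_bound k r h \<le> int (card (sum_values k a r h))"
    using card_sums_below[where a=a, OF pos s p mono] card_sums_above[where a=a, OF pos s q mono] one L by linarith
  moreover have "int (card {?lo..?hi}) = L_bound k r h"
    using L rank[OF s] by simp
  ultimately show ?thesis
    using \<open>card (sum_values k a r h) \<le> card {?lo..?hi}\<close> by linarith
qed

lemma sorted_list_of_arith_prog:
  assumes "A = (\<lambda>i. b + int i * d) ` {..<k}" "0 < d" "i < k"
  shows "sorted_list_of_set A ! i = b + int i * d"
proof -
  let ?xs = "map (\<lambda>i. b + int i * d) [0..<k]"
  have "sorted_wrt (<) ?xs"
    using \<open>0 < d\<close> by (simp add: sorted_wrt_iff_nth_less)
  moreover have "set ?xs = A"
    using assms by (simp add: lessThan_atLeast0)
  ultimately have "sorted_list_of_set A = ?xs"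
    by (metis sorted_list_of_set.idem_if_sorted_distinct strict_sorted_iff)
  then show ?thesis
    using \<open>i < k\<close> by simp
qed

lemma arith_prog_positive_step:
  assumes "arith_prog k A"
  obtains b d where "0 < d" "A = (\<lambda>i. b + int i * d) ` {..<k}"
proof -
  obtain b d where d: "d \<noteq> 0" and A: "A = (\<lambda>i. b + int i * d) ` {..<k}"
    using assms by (auto simp: arith_prog_def)
  show ?thesis
  proof (cases "0 < d")
    case True
    then show ?thesis
      using that A by blast
  next
    case False
    \<comment> \<open>For a negative step, the progression is read backwards from its last
      term.\<close>
    let ?g = "\<lambda>i. (b + (int k - 1) * d) + int i * (- d)"
    have "A = ?g ` (\<lambda>i. k - Suc i) ` {..<k}"
      unfolding A image_image by (rule image_cong) (auto simp: of_nat_diff algebra_simps)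
    also have "(\<lambda>i. k - Suc i) ` {..<k} = {..<k}"
    proof (rule set_eqI)
      fix x
      show "x \<in> (\<lambda>i. k - Suc i) ` {..<k} \<longleftrightarrow> x \<in> {..<k}"
        by (auto intro!: image_eqI[of _ _ "k - Suc x"])
    qed
    finally show ?thesis
      using that[of "- d"] False d by simp
  qed
qed

section \<open>The equivalence for sets of integers\<close>

theorem theorem2:
  fixes k :: nat and r :: "nat \<Rightarrow> int" and h :: int and A :: "int set"
  assumes "k \<ge> 5"
    and "\<And>j. j < k \<Longrightarrow> r j > 0"
    and "2 \<le> h" and "h \<le> (\<Sum>j<k. r j) - 2"
    and "card A = k"
  shows "int (card (restricted_sumset r h A)) = L_bound k r h \<longleftrightarrow> arith_prog k A"
proof -
  let ?a = "\<lambda>i. sorted_list_of_set A ! i"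
  have fin: "finite A"
    using assms by (intro card_ge_0_finite) simp
  have S: "restricted_sumset r h A = sum_values k ?a r h"
    using assms(5) by (auto simp: restricted_sumset_def sum_values_def config_def wsum_def)
  have mono: "?a i < ?a (Suc i)" if "Suc i < k" for i
    using strict_sorted_list_of_set[of A] that assms(5) by (simp add: sorted_wrt_iff_nth_less)
  show ?thesis
    unfolding S
  proof
    assume card: "int (card (sum_values k ?a r h)) = L_bound k r h"
    define d where "d = ?a 1 - ?a 0"
    have gap: "?a (Suc i) - ?a i = d" if "Suc i < k" for i
      unfolding d_def
      using all_gaps_equal[OF assms(1), of ?a i] far_gaps_equal[OF assms(2-4) mono card] that by blast
    have val: "?a i = ?a 0 + int i * d" if "i < k" for i
      using that
    proof (induction i)
      case (Suc i)
      then show ?case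
        using gap[of i] by (simp add: algebra_simps)
    qed simp
    have "A = set (sorted_list_of_set A)"
      using fin by simp
    also have "\<dots> = ?a ` {..<k}"
      using assms(5) by (auto simp: set_conv_nth)
    also have "\<dots> = (\<lambda>i. ?a 0 + int i * d) ` {..<k}"
      by (intro image_cong refl val) simp
    finally have "A = (\<lambda>i. ?a 0 + int i * d) ` {..<k}" .
    moreover have "d \<noteq> 0"
      using mono[of 0] assms(1) by (simp add: d_def)
    ultimately show "arith_prog k A"
      unfolding arith_prog_def by blast
  next
    assume "arith_prog k A"
    \<comment> \<open>With a positive step, the progression lists \<open>A\<close> in increasing
      order, as \<open>sorted_list_of_set\<close> does.\<close>
    then obtain b d where "0 < d" and A: "A = (\<lambda>i. b + int i * d) ` {..<k}"
      by (rule arith_prog_positive_step)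
    then show "int (card (sum_values k ?a r h)) = L_bound k r h"
      using card_sums_affine[of k r h d ?a b] sorted_list_of_arith_prog[OF A] assms by simp
  qed
qed

end
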